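(* Let $m>n$ and let $G:\mathbb{R}^m\to\mathbb{R}^n$ be Lipschitz continuous with constant $L$ and uniformly Newton differentiable on $\mathcal{Z}=\{\bar x\in\mathbb{R}^m \mid G(\bar x)=0\}$, with Newton differential $\mathcal{H}G$. Assume that the projection operator onto $\mathcal{Z}$ is Lipschitz continuous with constant $L_{\mathcal{Z}}$. Assume that $\mathcal{H}G$ is geometrically compatible with $\mathcal{Z}$ with constant $P$, and that for all $x\in\mathbb{R}^m$ all $H\in\mathcal{H}G(x)$ have full rank. Furthermore, assume that the set $\bigcup_{x\in\mathbb{R}^m}\{\|H^{+}\| \mid H\in\mathcal{H}G(x)\}$ is bounded by some $\Omega\in(0,\infty)$. Then there exists $r>0$ such that for every sequence $\{x^k\}_{k\in\mathbb{N}}$ with $\operatorname{dist}(x^0,\mathcal{Z})<r$ and $$x^{k+1}\in\mathcal{N}_{\mathcal{H}G}(x^k)\quad\text{for all }k\in\mathbb{N},$$ there is a sequence $\{c^k\}_{k\in\mathbb{N}}$ of positive real numbers converging to $0$ (here $k$ is an index, not an exponent) such that $$\forall k\in\mathbb{N},\quad \operatorname{dist}(x^{k+1},\mathcal{Z})\le c^k\operatorname{dist}(x^k,\mathcal{Z}).$$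
   Context: Norms are Euclidean norms and the induced operator norm. For a set $S\subseteq\mathbb{R}^m$, $\operatorname{proj}_S x=\operatorname{argmin}_{y\in S}\|x-y\|^2$; that the projection operator onto $S$ is Lipschitz continuous means that it is a single-valued map $\mathbb{R}^m\to S$ which is Lipschitz continuous. $\rightrightarrows$ denotes a set-valued mapping. Pseudo-inverse: for $A\in\mathbb{R}^{n\times m}$ of full rank with $m>n$, $A^{+}=A^T(AA^T)^{-1}$. Uniform (weak) Newton differentiability: let $V\subseteq U\subseteq\mathbb{R}^m$. $G:U\to\mathbb{R}^n$ is uniformly weakly Newton differentiable on $V$ if there exist a set-valued mapping $\mathcal{H}G:U\rightrightarrows\mathbb{R}^{n\times m}$ (called a Newton differential of $G$) and a constant $M$ such that for every $\varepsilon>0$ there is $\delta>0$ such that for all $x\in U$, $y\in V$ with $x\ne y$, $\|x-y\|\le\delta$, $$\sup_{H\in\mathcal{H}G(x)}\frac{\|G(x)-G(y)-H(x-y)\|}{\|x-y\|}<M+\varepsilon.$$ It is uniformly Newton differentiable on $V$ (with Newton differential $\mathcal{H}G$) if the same holds with the right-hand side replaced by $\varepsilon$. Here $U=\mathbb{R}^m$, $V=\mathcal{Z}$. Under-determined Newton-type operator: for $x\in\mathbb{R}^m$ and $H\in\mathcal{H}G(x)$ put $\mathcal{A}(x,H)=\{y\in\mathbb{R}^m\mid G(x)+H(y-x)=0\}$, and let $\mathcal{N}_{\mathcal{H}G}:\mathbb{R}^m\rightrightarrows\mathbb{R}^m$, $\mathcal{N}_{\mathcal{H}G}(x)=\{\operatorname{proj}_{\mathcal{A}(x,H)}x\mid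 H\in\mathcal{H}G(x)\}$, which is assumed to be nowhere empty. Geometric compatibility: for $G$ uniformly weakly Newton differentiable on $\mathcal{Z}$ with Newton differential $\mathcal{H}G$, $\mathcal{H}G$ is geometrically compatible with $\mathcal{Z}$ (with constant $P$) if $P\ge1$ and there exists $\delta>0$ such that for all $x\in\mathbb{R}^m$ with $\operatorname{dist}(x,\mathcal{Z})<\delta$ and all $H\in\mathcal{H}G(x)$, $\operatorname{proj}_{\mathcal{Z}}\operatorname{proj}_{\mathcal{A}(x,H)}x$ exists, is single-valued, and $$\|\operatorname{proj}_{\mathcal{A}(x,H)}x-\operatorname{proj}_{\mathcal{Z}}\operatorname{proj}_{\mathcal{A}(x,H)}x\|\le P\,\|\operatorname{proj}_{\mathcal{Z}}\operatorname{proj}_{\mathcal{A}(x,H)}x-\operatorname{proj}_{\mathcal{A}(x,H)}\operatorname{proj}_{\mathcal{Z}}\operatorname{proj}_{\mathcal{A}(x,H)}x\|.$$ *)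

theory Defs
  imports "HOL-Analysis.Analysis"
begin

text \<open>An \<open>n \<times> m\<close> matrix has type \<open>real ^ 'm ^ 'n\<close>. The library norm on this type is the
  Frobenius norm, whereas matrices here are measured in the induced operator norm.\<close>

definition op_norm :: "real ^ 'm ^ 'n \<Rightarrow> real" where
  "op_norm A = onorm ((*v) A)"

definition pseudo_inverse :: "real ^ 'm ^ 'n \<Rightarrow> real ^ 'n ^ 'm" where
  "pseudo_inverse A = transpose A ** matrix_inv (A ** transpose A)"

definition full_rank :: "real ^ 'm ^ 'n \<Rightarrow> bool" where
  "full_rank A \<longleftrightarrow> rank A = min CARD('m) CARD('n)"

text \<open>The projection is the set of all minimizers; it may be empty or have several elements.\<close>

definition proj :: "'a::real_normed_vector set \<Rightarrow> 'a \<Rightarrow> 'a set" where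
  "proj S x = {y. is_arg_min (\<lambda>y. (norm (x - y))\<^sup>2) (\<lambda>y. y \<in> S) y}"

definition lipschitz_projection :: "real \<Rightarrow> 'a::real_normed_vector set \<Rightarrow> bool" where
  "lipschitz_projection L S \<longleftrightarrow> (\<exists>p. (\<forall>x. proj S x = {p x}) \<and> L-lipschitz_on UNIV p)"

text \<open>The supremum is taken in the extended reals, so that it is \<open>\<infinity>\<close> for an unbounded family
  of quotients and \<open>-\<infinity>\<close> if \<open>HG x\<close> is empty.\<close>

definition newton_quotient ::
  "(real ^ 'm \<Rightarrow> real ^ 'n) \<Rightarrow> (real ^ 'm \<Rightarrow> (real ^ 'm ^ 'n) set) \<Rightarrow> real ^ 'm \<Rightarrow> real ^ 'm \<Rightarrow> ereal"
where
  "newton_quotient G HG x y =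
    (SUP H\<in>HG x. ereal (norm (G x - G y - H *v (x - y)) / norm (x - y)))"

definition unif_weakly_newton_differentiable ::
  "(real ^ 'm) set \<Rightarrow> (real ^ 'm) set \<Rightarrow> (real ^ 'm \<Rightarrow> real ^ 'n) \<Rightarrow>
    (real ^ 'm \<Rightarrow> (real ^ 'm ^ 'n) set) \<Rightarrow> bool"
where
  "unif_weakly_newton_differentiable U V G HG \<longleftrightarrow>
    V \<subseteq> U \<and>
    (\<exists>M::real. \<forall>\<epsilon>>0. \<exists>\<delta>>0. \<forall>x\<in>U. \<forall>y\<in>V. x \<noteq> y \<and> norm (x - y) \<le> \<delta> \<longrightarrow>
      newton_quotient G HG x y < ereal (M + \<epsilon>))"

definition unif_newton_differentiable ::
  "(real ^ 'm) set \<Rightarrow> (real ^ 'm) set \<Rightarrow> (real ^ 'm \<Rightarrow> real ^ 'n) \<Rightarrow>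
    (real ^ 'm \<Rightarrow> (real ^ 'm ^ 'n) set) \<Rightarrow> bool"
where
  "unif_newton_differentiable U V G HG \<longleftrightarrow>
    V \<subseteq> U \<and>
    (\<forall>\<epsilon>>0. \<exists>\<delta>>0. \<forall>x\<in>U. \<forall>y\<in>V. x \<noteq> y \<and> norm (x - y) \<le> \<delta> \<longrightarrow>
      newton_quotient G HG x y < ereal \<epsilon>)"

definition newton_affine ::
  "(real ^ 'm \<Rightarrow> real ^ 'n) \<Rightarrow> real ^ 'm \<Rightarrow> real ^ 'm ^ 'n \<Rightarrow> (real ^ 'm) set"
where
  "newton_affine G x H = {y. G x + H *v (y - x) = 0}"

definition newton_operator ::
  "(real ^ 'm \<Rightarrow> real ^ 'n) \<Rightarrow> (real ^ 'm \<Rightarrow> (real ^ 'm ^ 'n) set) \<Rightarrow> real ^ 'm \<Rightarrow> (real ^ 'm) set"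
where
  "newton_operator G HG x = (\<Union>H\<in>HG x. proj (newton_affine G x H) x)"

text \<open>Below, \<open>a\<close>, \<open>b\<close>, \<open>c\<close> are the successive projections of \<open>x\<close> onto the affine space,
  onto \<open>Z\<close>, and back onto the affine space. Onto the affine space, existence of \<open>a\<close> already
  gives its uniqueness and the existence and uniqueness of \<open>c\<close>, so only the condition on
  \<open>b\<close> is a genuine existence and uniqueness requirement beyond the existence of \<open>a\<close>.
  \<open>infdist x Z\<close> is the distance to \<open>Z\<close> only for nonempty \<open>Z\<close> (it is \<open>0\<close> for \<open>Z = {}\<close>).\<close>

definition geometrically_compatible ::
  "(real ^ 'm \<Rightarrow> real ^ 'n) \<Rightarrow> (real ^ 'm \<Rightarrow> (real ^ 'm ^ 'n) set) \<Rightarrow> (real ^ 'm) set \<Rightarrow>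
    real \<Rightarrow> bool"
where
  "geometrically_compatible G HG Z P \<longleftrightarrow>
    unif_weakly_newton_differentiable UNIV Z G HG \<and>
    P \<ge> 1 \<and>
    (\<exists>\<delta>>0. \<forall>x. infdist x Z < \<delta> \<longrightarrow> (\<forall>H\<in>HG x. \<exists>a b c.
      proj (newton_affine G x H) x = {a} \<and>
      proj Z a = {b} \<and>
      proj (newton_affine G x H) b = {c} \<and>
      norm (a - b) \<le> P * norm (b - c)))"

end

theory Submission
  imports Defs
begin

text \<open>Write \<open>d\<close> for the distance of \<open>x\<close> to \<open>Z\<close>. Since \<open>x - H\<^sup>+ (G x)\<close> lies in the affine space
  of the linearized equation, the Newton step satisfies \<open>\<parallel>a - x\<parallel> \<le> \<Omega> \<parallel>G x\<parallel> \<le> \<Omega> L d\<close>, so the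
  projection \<open>b\<close> of \<open>a\<close> onto \<open>Z\<close> is within \<open>(1 + 2 \<Omega> L) d\<close> of \<open>x\<close>. Projecting \<open>b\<close> back costs at
  most \<open>\<Omega> \<parallel>G x - G b - H (x - b)\<parallel>\<close>, because \<open>G b = 0\<close>, and Newton differentiability makes this
  \<open>o(d)\<close>. Geometric compatibility transfers the bound to \<open>\<parallel>a - b\<parallel>\<close>, the distance of the new
  iterate to \<open>Z\<close>.\<close>

text \<open>Full row rank makes \<open>transpose H\<close> injective. If
  \<open>H ** transpose H\<close> kills \<open>v\<close>, then the squared norm of
  \<open>transpose H *v v\<close> is 0, so \<open>v = 0\<close>; this square matrix is thus
  injective and invertible.\<close>

lemma matrix_mult_pseudo_inverse:
  fixes H :: "real ^ 'm ^ 'n"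
  assumes "full_rank H" and "CARD('m) \<ge> CARD('n)"
  shows "H ** pseudo_inverse H = mat 1"
proof -
  have "rank (transpose H) = CARD('n)"
    using assms by (simp add: full_rank_def rank_transpose)
  then have inj: "inj ((*v) (transpose H))"
    by (simp add: full_rank_injective)
  have "inj ((*v) (H ** transpose H))"
  proof (rule linear_injective_0[THEN iffD2, rule_format, OF matrix_vector_mul_linear])
    fix v assume "(H ** transpose H) *v v = 0"
    then have "H *v (v v* H) = 0"
      by (simp flip: matrix_vector_mul_assoc)
    then have "(v v* H) \<bullet> (v v* H) = 0"
      unfolding dot_lmul_matrix by simp
    then have "transpose H *v v = transpose H *v 0"
      by simp
    then show "v = 0"
      using inj by (meson injD)
  qed
  then have "invertible (H ** transpose H)"
    by (simp add: invertible_left_inverse matrix_left_invertible_injective inj_on_def)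
  then have "(H ** transpose H) ** matrix_inv (H ** transpose H) = mat 1"
    unfolding invertible_def matrix_inv_def by (rule someI_ex[THEN conjunct1])
  then show ?thesis
    by (simp add: pseudo_inverse_def matrix_mul_assoc)
qed

text \<open>Squaring is monotone on nonnegative reals, so a minimizer of the squared norm also
  minimizes the norm, and the infimum in \<open>infdist\<close> is attained at
  \<open>y\<close>.\<close>

lemma projD:
  assumes "y \<in> proj S x"
  shows "y \<in> S" and "\<And>z. z \<in> S \<Longrightarrow> norm (x - y) \<le> norm (x - z)"
    and "infdist x S = norm (x - y)"
proof -
  show S: "y \<in> S"
    using assms by (simp add: proj_def is_arg_min_def)
  show le: "norm (x - y) \<le> norm (x - z)" if "z \<in> S" for z
  proof -
    have "(norm (x - y))\<^sup>2 \<le> (norm (x - z))\<^sup>2"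
      using assms that by (auto simp: proj_def is_arg_min_def not_less)
    then show ?thesis
      by (rule power2_le_imp_le) simp
  qed
  have "S \<noteq> {}"
    using S by blast
  show "infdist x S = norm (x - y)"
  proof (rule antisym)
    show "infdist x S \<le> norm (x - y)"
      using infdist_le[OF S, of x] by (simp add: dist_norm)
    show "norm (x - y) \<le> infdist x S"
      unfolding infdist_notempty[OF \<open>S \<noteq> {}\<close>] dist_norm
      using \<open>S \<noteq> {}\<close> le by (intro cINF_greatest) auto
  qed
qed

text \<open>Correcting \<open>y\<close> by the pseudo-inverse applied to its linearized residual
  gives a point of the affine space, and \<open>a\<close> is at least as close to \<open>y\<close>.
  Keeping \<open>y\<close> apart from \<open>x\<close> covers both the Newton step and the
  projection of \<open>b\<close>.\<close>

lemma norm_proj_newton_affine_le: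
  fixes G :: "real ^ 'm \<Rightarrow> real ^ 'n"
  assumes rank: "full_rank H" "CARD('m) \<ge> CARD('n)"
    and bound: "op_norm (pseudo_inverse H) \<le> \<Omega>"
    and a: "a \<in> proj (newton_affine G x H) y"
  shows "norm (y - a) \<le> \<Omega> * norm (G x + H *v (y - x))"
proof -
  define w where "w = G x + H *v (y - x)"
  define z where "z = y - pseudo_inverse H *v w"
  have "H *v (pseudo_inverse H *v w) = w"
    by (simp add: matrix_vector_mul_assoc matrix_mult_pseudo_inverse[OF rank])
  then have "z \<in> newton_affine G x H"
    by (simp add: z_def w_def newton_affine_def algebra_simps)
  then have "norm (y - a) \<le> norm (y - z)"
    by (rule projD(2)[OF a])
  also have "\<dots> = norm (pseudo_inverse H *v w)"
    by (simp add: z_def)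
  also have "\<dots> \<le> op_norm (pseudo_inverse H) * norm w"
    unfolding op_norm_def by (intro onorm matrix_vector_mul_bounded_linear)
  also have "\<dots> \<le> \<Omega> * norm w"
    using bound by (intro mult_right_mono) auto
  finally show ?thesis
    by (simp add: w_def)
qed

text \<open>The summand \<open>1 / Suc k\<close> in the rates only makes them positive, also where a quotient is
  \<open>0\<close>, in particular \<open>0 / 0\<close>.\<close>

lemma superlinear_rates:
  fixes d :: "nat \<Rightarrow> real"
  assumes nonneg: "\<And>k. d k \<ge> 0"
    and step: "\<And>\<eta>. \<eta> > 0 \<Longrightarrow> \<exists>\<rho>>0. \<forall>k. d k < \<rho> \<longrightarrow> d (Suc k) \<le> \<eta> * d k"
    and lim: "d \<longlonglongrightarrow> 0"
    and contract: "\<And>k. d (Suc k) \<le> d k"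
  shows "\<exists>c :: nat \<Rightarrow> real. (\<forall>k. c k > 0) \<and> c \<longlonglongrightarrow> 0 \<and> (\<forall>k. d (Suc k) \<le> c k * d k)"
proof (intro exI conjI allI)
  define q where "q k = d (Suc k) / d k" for k
  let ?c = "\<lambda>k. q k + 1 / real (Suc k)"
  have q: "q k \<ge> 0" for k
    using nonneg by (simp add: q_def)
  show "?c k > 0" for k
    using q[of k] by (simp add: add_nonneg_pos)
  have "q \<longlonglongrightarrow> 0"
  proof (rule order_tendstoI)
    show "\<forall>\<^sub>F k in sequentially. y < q k" if "y < 0" for y
      using that q by (auto intro: always_eventually less_le_trans)
    fix y :: real
    assume "y > 0"
    \<comment> \<open>Halving \<open>y\<close> leaves room for the strict inequality
      \<open>q k < y\<close>.\<close>
    then obtain \<rho> where \<rho>: "\<rho> > 0" "\<And>k. d k < \<rho> \<Longrightarrow> d (Suc k) \<le> y / 2 * d k"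
      using step[of "y / 2"] by auto
    have "q k < y" if "d k < \<rho>" for k
    proof (cases "d k = 0")
      case False
      then have "d k > 0"
        using nonneg[of k] by simp
      then have "q k \<le> y / 2"
        using \<rho>(2)[OF that] by (simp add: q_def pos_divide_le_eq)
      then show ?thesis
        using \<open>y > 0\<close> by simp
    qed (use \<open>y > 0\<close> in \<open>simp add: q_def\<close>)
    moreover have "\<forall>\<^sub>F k in sequentially. d k < \<rho>"
      using order_tendstoD(2)[OF lim \<rho>(1)] .
    ultimately show "\<forall>\<^sub>F k in sequentially. q k < y"
      by (auto elim: eventually_mono)
  qed
  then show "?c \<longlonglongrightarrow> 0"
    using tendsto_add[OF _ LIMSEQ_Suc[OF lim_1_over_n]] by fastforce
  show "d (Suc k) \<le> ?c k * d k" for k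
  \<comment> \<open>Where \<open>d k = 0\<close>, the quotient carries no information and
    monotonicity gives the bound.\<close>
  proof (cases "d k = 0")
    case True
    then show ?thesis
      using contract[of k] by simp
  next
    case False
    then have "d (Suc k) = q k * d k"
      by (simp add: q_def)
    then show ?thesis
      using nonneg[of k] by (simp add: distrib_right)
  qed
qed

text \<open>Halving never leaves the region below \<open>r\<close>, so one induction carries both
  the geometric bound and \<open>d k < r\<close>.\<close>

lemma local_contraction_tendsto_0:
  fixes d :: "nat \<Rightarrow> real"
  assumes nonneg: "\<And>k. d k \<ge> 0"
    and half: "\<And>k. d k < r \<Longrightarrow> d (Suc k) \<le> 1 / 2 * d k"
    and start: "d 0 < r"
  shows "d \<longlonglongrightarrow> 0" and "\<And>k. d (Suc k) \<le> d k"
proof -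
  have le: "d k \<le> (1 / 2) ^ k * d 0 \<and> d k < r" for k
  proof (induction k)
    case (Suc k)
    then show ?case
      using half[of k] nonneg[of k] by simp
  qed (use start in simp)
  show "d (Suc k) \<le> d k" for k
    using half[of k] le[of k] nonneg[of k] by simp
  have "(\<lambda>k. (1 / 2) ^ k * d 0) \<longlonglongrightarrow> 0"
    by (intro tendsto_mult_left_zero LIMSEQ_realpow_zero) auto
  then show "d \<longlonglongrightarrow> 0"
    by (rule tendsto_sandwich[OF _ _ tendsto_const, rotated 2]) (use nonneg le in auto)
qed

theorem theorem3p9:
  fixes G :: "real ^ 'm \<Rightarrow> real ^ 'n"
    and HG :: "real ^ 'm \<Rightarrow> (real ^ 'm ^ 'n) set"
    and Z :: "(real ^ 'm) set"
    and L L\<^sub>Z P \<Omega> :: real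
  assumes "CARD('m) > CARD('n)"
    and "Z = {z. G z = 0}"
    and "L-lipschitz_on UNIV G"
    and "unif_newton_differentiable UNIV Z G HG"
    and "\<forall>x. newton_operator G HG x \<noteq> {}"
    and "lipschitz_projection L\<^sub>Z Z"
    and "geometrically_compatible G HG Z P"
    and "\<forall>x. \<forall>H\<in>HG x. full_rank H"
    and "\<Omega> > 0"
    and "\<forall>t \<in> (\<Union>x. {op_norm (pseudo_inverse H) |H. H \<in> HG x}). t \<le> \<Omega>"
  shows "\<exists>r>0. \<forall>x :: nat \<Rightarrow> real ^ 'm.
    infdist (x 0) Z < r \<and> (\<forall>k. x (Suc k) \<in> newton_operator G HG (x k)) \<longrightarrow>
    (\<exists>c :: nat \<Rightarrow> real. (\<forall>k. c k > 0) \<and> c \<longlonglongrightarrow> 0 \<and>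
      (\<forall>k. infdist (x (Suc k)) Z \<le> c k * infdist (x k) Z))"
proof -
  note Z = assms(2) and \<Omega> = assms(9)
  have card: "CARD('m) \<ge> CARD('n)"
    using assms(1) by simp
  have L: "L \<ge> 0" "\<And>x y. norm (G x - G y) \<le> L * norm (x - y)"
    using assms(3) by (auto simp: lipschitz_on_def dist_norm)
  obtain p where p: "\<And>x. proj Z x = {p x}"
    using assms(6) by (auto simp: lipschitz_projection_def)
  obtain \<delta>\<^sub>0 where "P \<ge> 1" and \<delta>\<^sub>0: "\<delta>\<^sub>0 > 0"
    "\<And>x H. infdist x Z < \<delta>\<^sub>0 \<Longrightarrow> H \<in> HG x \<Longrightarrow> \<exists>a b c.
      proj (newton_affine G x H) x = {a} \<and> proj Z a = {b} \<and>
      proj (newton_affine G x H) b = {c} \<and> norm (a - b) \<le> P * norm (b - c)"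
    using assms(7) unfolding geometrically_compatible_def by metis
  have pinv: "op_norm (pseudo_inverse H) \<le> \<Omega>" if "H \<in> HG x" for H x
    using assms(10) that by blast
  define K where "K = 1 + 2 * \<Omega> * L"
  have "K > 0"
    using \<Omega> L(1) by (simp add: K_def add_pos_nonneg)
  have step: "\<exists>\<rho>>0. \<forall>x a. infdist x Z < \<rho> \<and> a \<in> newton_operator G HG x \<longrightarrow>
    infdist a Z \<le> \<eta> * infdist x Z" if "\<eta> > 0" for \<eta>
  proof -
    \<comment> \<open>Chosen so that \<open>P * \<Omega> * \<epsilon> * K = \<eta>\<close> at the
      end of the chain of estimates.\<close>
    define \<epsilon> where "\<epsilon> = \<eta> / (P * \<Omega> * K)"
    have "\<epsilon> > 0"
      using that \<open>P \<ge> 1\<close> \<Omega> \<open>K > 0\<close> by (simp add: \<epsilon>_def)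
    then obtain \<delta> where \<delta>: "\<delta> > 0"
      "\<And>x y. y \<in> Z \<Longrightarrow> x \<noteq> y \<Longrightarrow> norm (x - y) \<le> \<delta> \<Longrightarrow> newton_quotient G HG x y < ereal \<epsilon>"
      using assms(4) unfolding unif_newton_differentiable_def by blast
    \<comment> \<open>The bound \<open>\<delta>\<^sub>0\<close> gives access to geometric
      compatibility; \<open>\<delta> / K\<close> ensures
      \<open>norm (x - b) \<le> \<delta>\<close>.\<close>
    have "infdist a Z \<le> \<eta> * infdist x Z"
      if x: "infdist x Z < min \<delta>\<^sub>0 (\<delta> / K)" and a: "a \<in> newton_operator G HG x" for x a
    proof -
      let ?d = "infdist x Z"
      obtain H where H: "H \<in> HG x" "a \<in> proj (newton_affine G x H) x"
        using a by (auto simp: newton_operator_def)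
      then obtain b c where b: "b \<in> proj Z a" and c: "c \<in> proj (newton_affine G x H) b"
        and P: "norm (a - b) \<le> P * norm (b - c)"
        using \<delta>\<^sub>0(2)[OF _ H(1)] x by (metis min_less_iff_conj singletonD singletonI)
      have px: "p x \<in> Z" "?d = norm (x - p x)"
        using projD[of "p x" Z x] p by auto
      have "norm (x - a) \<le> \<Omega> * norm (G x)"
        using norm_proj_newton_affine_le[OF _ card pinv[OF H(1)] H(2)] assms(8) H(1) by simp
      also have "\<dots> \<le> \<Omega> * (L * ?d)"
        using L(2)[of x "p x"] px \<Omega> Z by (intro mult_left_mono) auto
      finally have xa: "norm (x - a) \<le> \<Omega> * (L * ?d)" .
      \<comment> \<open>Comparing \<open>b\<close> with \<open>p x\<close> and then passing through
        \<open>a\<close> counts \<open>norm (x - a)\<close> twice, whence the factor 2 in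
        \<open>K\<close>.\<close>
      have "norm (a - b) \<le> norm (a - p x)"
        by (rule projD(2)[OF b px(1)])
      also have "\<dots> \<le> norm (x - a) + ?d"
        using norm_triangle_ineq[of "a - x" "x - p x"] px by (simp add: norm_minus_commute)
      finally have "norm (x - b) \<le> 2 * norm (x - a) + ?d"
        using norm_triangle_ineq[of "x - a" "a - b"] by simp
      also have "\<dots> \<le> K * ?d"
        using xa by (simp add: K_def algebra_simps)
      finally have xb: "norm (x - b) \<le> K * ?d" .
      have bZ: "b \<in> Z" "G b = 0"
        using projD(1)[OF b] Z by auto
      \<comment> \<open>As \<open>G b = 0\<close>, the left side is the numerator of the Newton
        quotient at \<open>x\<close> and \<open>b\<close>. That quotient is controlled only for
        distinct points; if \<open>x = b\<close>, the residual is \<open>G b = 0\<close>.\<close>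
      have "norm (G x + H *v (b - x)) \<le> \<epsilon> * norm (x - b)"
      proof (cases "x = b")
        case True
        then show ?thesis
          using bZ by simp
      next
        case False
        have "norm (x - b) \<le> \<delta>"
          using xb x \<open>K > 0\<close> by (simp add: pos_less_divide_eq mult.commute)
        then have "newton_quotient G HG x b < ereal \<epsilon>"
          using \<delta>(2)[OF bZ(1) False] by simp
        then have "ereal (norm (G x - G b - H *v (x - b)) / norm (x - b)) < ereal \<epsilon>"
          unfolding newton_quotient_def using H(1) by (meson SUP_upper le_less_trans)
        then have "norm (G x - G b - H *v (x - b)) \<le> \<epsilon> * norm (x - b)"
          using False by (simp add: pos_divide_less_eq)
        then show ?thesis
          by (simp add: bZ algebra_simps)
      qed
      then have "norm (b - c) \<le> \<Omega> * (\<epsilon> * norm (x - b))"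
        using norm_proj_newton_affine_le[OF _ card pinv[OF H(1)] c] assms(8) H(1) \<Omega>
        by (meson mult_left_mono order.strict_implies_order order_trans)
      also have "\<dots> \<le> \<Omega> * (\<epsilon> * (K * ?d))"
        using xb \<Omega> \<open>\<epsilon> > 0\<close> by (intro mult_left_mono) auto
      finally have "P * norm (b - c) \<le> P * (\<Omega> * (\<epsilon> * (K * ?d)))"
        using \<open>P \<ge> 1\<close> by (intro mult_left_mono) auto
      also have "\<dots> = \<eta> * ?d"
        using \<open>P \<ge> 1\<close> \<Omega> \<open>K > 0\<close> by (simp add: \<epsilon>_def)
      finally show ?thesis
        using P projD(3)[OF b] by simp
    qed
    then show ?thesis
      using \<delta>(1) \<delta>\<^sub>0(1) \<open>K > 0\<close> by (intro exI[of _ "min \<delta>\<^sub>0 (\<delta> / K)"]) auto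
  qed
  \<comment> \<open>The factor 1/2 fixes \<open>r\<close> before any sequence is given. It forces
    the distances to 0, so that \<open>step\<close> eventually applies with every
    \<open>\<eta> > 0\<close>.\<close>
  obtain r where r: "r > 0" "\<And>x a. infdist x Z < r \<Longrightarrow> a \<in> newton_operator G HG x \<Longrightarrow>
    infdist a Z \<le> 1 / 2 * infdist x Z"
    using step[of "1 / 2"] by auto
  show ?thesis
  proof (intro exI[of _ r] conjI allI impI)
    fix x :: "nat \<Rightarrow> real ^ 'm"
    assume x: "infdist (x 0) Z < r \<and> (\<forall>k. x (Suc k) \<in> newton_operator G HG (x k))"
    note contr = local_contraction_tendsto_0[of "\<lambda>k. infdist (x k) Z" r]
    show "\<exists>c :: nat \<Rightarrow> real. (\<forall>k. c k > 0) \<and> c \<longlonglongrightarrow> 0 \<and>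
      (\<forall>k. infdist (x (Suc k)) Z \<le> c k * infdist (x k) Z)"
    proof (rule superlinear_rates)
      show "\<exists>\<rho>>0. \<forall>k. infdist (x k) Z < \<rho> \<longrightarrow> infdist (x (Suc k)) Z \<le> \<eta> * infdist (x k) Z"
        if "\<eta> > 0" for \<eta>
        using step[OF that] x by blast
      show "(\<lambda>k. infdist (x k) Z) \<longlonglongrightarrow> 0"
        using contr(1) r(2) x infdist_nonneg by blast
      show "infdist (x (Suc k)) Z \<le> infdist (x k) Z" for k
        using contr(2) r(2) x infdist_nonneg by blast
    qed (rule infdist_nonneg)
  qed (rule r(1))
qed

end
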